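(* Let $\varkappa\in\mathbb{N}$ with $\varkappa>n/2$. Let $\sigma:\mathbb{Z}^n\times\mathbb{T}^n\to\mathbb{C}$ be such that $\sigma(k,\cdot)\in C^{\varkappa}(\mathbb{T}^n)$ for every $k$, and assume that there is a constant $C$ with $$|\partial_x^\beta\sigma(k,x)|\le C\quad\text{for all }(k,x)\in\mathbb{Z}^n\times\mathbb{T}^n\text{ and all }|\beta|\le\varkappa.$$ Then $\mathrm{Op}(\sigma)$ extends to a bounded operator on $\ell^2(\mathbb{Z}^n)$.
   Context: $\mathbb{T}^n=\mathbb{R}^n/\mathbb{Z}^n$ with normalised Lebesgue measure. For rapidly decreasing $f:\mathbb{Z}^n\to\mathbb{C}$, $\widehat f(x)=\sum_{k\in\mathbb{Z}^n}e^{-2\pi i k\cdot x}f(k)$ and $\mathrm{Op}(\sigma)f(k)=\int_{\mathbb{T}^n}e^{2\pi i k\cdot x}\sigma(k,x)\widehat f(x)\,dx$, $k\in\mathbb{Z}^n$. *)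

theory Defs
  imports "HOL-Analysis.Analysis"
begin

text \<open>
  The lattice $Z^n$ is the type \<open>int ^ 'n\<close>, with $n$ = \<open>CARD('n)\<close>. Functions on the torus
  $T^n = R^n / Z^n$ are represented by $Z^n$-periodic functions on \<open>real ^ 'n\<close>, and the
  normalised Lebesgue measure of the torus by Lebesgue measure on the unit cube \<open>cbox 0 1\<close>
  (here \<open>1\<close> is the all-ones vector).
\<close>

definition lattice_vec :: "int ^ 'n \<Rightarrow> real ^ 'n" where
  "lattice_vec k = (\<chi> i. of_int (k $ i))"

definition torus_periodic :: "(real ^ 'n \<Rightarrow> 'b) \<Rightarrow> bool" where
  "torus_periodic g \<longleftrightarrow> (\<forall>x m. g (x + lattice_vec m) = g x)"

definition partial :: "'n::finite \<Rightarrow> (real ^ 'n \<Rightarrow> complex) \<Rightarrow> real ^ 'n \<Rightarrow> complex" where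
  "partial i g x = vector_derivative (\<lambda>t. g (x + t *\<^sub>R axis i 1)) (at 0)"

primrec cont_diff :: "nat \<Rightarrow> (real ^ 'n \<Rightarrow> complex) \<Rightarrow> bool" where
  "cont_diff 0 g \<longleftrightarrow> continuous_on UNIV g"
| "cont_diff (Suc m) g \<longleftrightarrow> continuous_on UNIV g \<and>
     (\<forall>i. (\<forall>x. (\<lambda>t. g (x + t *\<^sub>R axis i 1)) differentiable (at (0::real))) \<and>
          cont_diff m (partial i g))"

definition cont_diff_torus :: "nat \<Rightarrow> (real ^ 'n \<Rightarrow> complex) \<Rightarrow> bool" where
  "cont_diff_torus m g \<longleftrightarrow> torus_periodic g \<and> cont_diff m g"

text \<open>
  For a multi-index \<open>\<beta>\<close>, the derivative $\partial^\beta = \partial_{i_1}^{\beta_{i_1}} \cdots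
  \partial_{i_n}^{\beta_{i_n}}$ needs an enumeration $i_1, \dots, i_n$ of the coordinates. As an
  abstract finite index type carries no order, an arbitrary enumeration is fixed once and for all;
  by the symmetry of mixed partial derivatives the choice does not matter for functions of class
  $C^{|\beta|}$.
\<close>

definition coord_enum :: "'n::finite list" where
  "coord_enum = (SOME is. distinct is \<and> set is = UNIV)"

definition multi_partial :: "('n::finite \<Rightarrow> nat) \<Rightarrow> (real ^ 'n \<Rightarrow> complex) \<Rightarrow> real ^ 'n \<Rightarrow> complex" where
  "multi_partial \<beta> g = foldr (\<lambda>i. partial i ^^ \<beta> i) coord_enum g"

definition rapidly_decreasing :: "(int ^ 'n \<Rightarrow> complex) \<Rightarrow> bool" where
  "rapidly_decreasing f \<longleftrightarrow>
     (\<forall>N::nat. \<exists>A. \<forall>k. (1 + norm (lattice_vec k)) ^ N * norm (f k) \<le> A)"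

definition lattice_fourier :: "(int ^ 'n \<Rightarrow> complex) \<Rightarrow> real ^ 'n \<Rightarrow> complex" where
  "lattice_fourier f x =
     (\<Sum>\<^sub>\<infinity>k\<in>UNIV. exp (- 2 * of_real pi * \<i> * of_real (lattice_vec k \<bullet> x)) * f k)"

definition Op ::
  "(int ^ 'n \<Rightarrow> real ^ 'n \<Rightarrow> complex) \<Rightarrow> (int ^ 'n \<Rightarrow> complex) \<Rightarrow> int ^ 'n \<Rightarrow> complex" where
  "Op \<sigma> f k =
     (LINT x:cbox 0 1|lborel.
        exp (2 * of_real pi * \<i> * of_real (lattice_vec k \<bullet> x)) * \<sigma> k x * lattice_fourier f x)"

definition ell2 :: "('a \<Rightarrow> complex) set" where
  "ell2 = {f. (\<lambda>k. (norm (f k))\<^sup>2) summable_on UNIV}"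

definition ell2_norm :: "('a \<Rightarrow> complex) \<Rightarrow> real" where
  "ell2_norm f = sqrt (\<Sum>\<^sub>\<infinity>k\<in>UNIV. (norm (f k))\<^sup>2)"

definition bounded_operator_ell2 :: "(('a \<Rightarrow> complex) \<Rightarrow> ('a \<Rightarrow> complex)) \<Rightarrow> bool" where
  "bounded_operator_ell2 T \<longleftrightarrow>
     (\<forall>f\<in>ell2. T f \<in> ell2) \<and>
     (\<forall>f\<in>ell2. \<forall>g\<in>ell2. T (\<lambda>k. f k + g k) = (\<lambda>k. T f k + T g k)) \<and>
     (\<forall>f\<in>ell2. \<forall>c. T (\<lambda>k. c * f k) = (\<lambda>k. c * T f k)) \<and>
     (\<exists>B. \<forall>f\<in>ell2. ell2_norm (T f) \<le> B * ell2_norm f)"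

end

theory Submission
  imports Defs
begin

text \<open>
  On the Fourier side, \<open>Op \<sigma>\<close> is the infinite matrix with entries \<open>a k (k - m)\<close>, where
  \<open>a k l\<close> is the Fourier coefficient at \<open>-l\<close> of \<open>\<sigma> k\<close>. Integrating by parts and applying Bessel's
  inequality to \<open>\<sigma> k\<close> and to its pure derivatives of order \<open>\<kappa>\<close> bounds
  \<open>\<Sum>l. w l * \<bar>a k l\<bar>\<^sup>2\<close> uniformly in \<open>k\<close>, where \<open>w l = 1 + \<Sum>i. \<bar>l i\<bar> ^ (2 * \<kappa>)\<close>. Since \<open>1 / w\<close> is
  summable for \<open>2 * \<kappa> > n\<close>, the Cauchy-Schwarz inequality with weight \<open>w (k - m)\<close> and summation
  over \<open>k\<close> give boundedness on the square-summable functions.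
\<close>


section \<open>Integrals of periodic functions over the unit cube\<close>

lemma lattice_vec_add: "lattice_vec (k + l) = lattice_vec k + lattice_vec l"
  and lattice_vec_uminus: "lattice_vec (- k) = - lattice_vec k"
  and lattice_vec_0 [simp]: "lattice_vec 0 = 0"
  and lattice_vec_axis: "lattice_vec (axis i 1) = axis i 1"
  by (simp_all add: lattice_vec_def vec_eq_iff axis_def)

lemma lattice_vec_nth [simp]: "lattice_vec k $ i = of_int (k $ i)"
  by (simp add: lattice_vec_def)

lemma lattice_vec_inner_axis [simp]: "lattice_vec k \<bullet> axis i 1 = of_int (k $ i)"
  by (simp add: inner_axis)

lemma torus_periodic_axis: "torus_periodic h \<Longrightarrow> h (x + axis i 1) = h x"
  using lattice_vec_axis[of i] unfolding torus_periodic_def by metis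

text \<open>Stretch the cube by \<open>t\<close> in direction \<open>i\<close> and cut the longer
  box in two ways: at coordinate 1, into the cube and a top slab, and at coordinate
  \<open>t\<close>, into a bottom slab and the translated cube. The two slabs differ by a shift by
  \<open>axis i 1\<close>, so periodicity gives them equal integrals.\<close>

lemma integral_translate_axis:
  fixes h :: "real ^ 'n \<Rightarrow> complex"
  assumes h: "torus_periodic h" "continuous_on UNIV h" and t: "0 \<le> t" "t \<le> 1"
  shows "integral (cbox 0 1) (\<lambda>x. h (x + t *\<^sub>R axis i 1)) = integral (cbox 0 1) h"
proof -
  define e :: "real ^ 'n" where "e = axis i 1"
  have e: "e \<in> Basis" by (simp add: e_def)
  have ix: "x \<bullet> e = x $ i" for x by (simp add: e_def inner_axis)
  have en: "e $ j = (if j = i then 1 else 0)" for j by (simp add: e_def axis_def)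
  have int: "h integrable_on cbox a b" for a b
    using h(2) by (meson continuous_on_subset integrable_continuous subset_UNIV)
  have box: "cbox 0 (1 + t *\<^sub>R e) \<inter> {x. x \<bullet> e \<le> 1} = cbox 0 1"
    "cbox 0 (1 + t *\<^sub>R e) \<inter> {x. x \<bullet> e \<ge> 1} = cbox e (1 + t *\<^sub>R e)"
    "cbox 0 (1 + t *\<^sub>R e) \<inter> {x. x \<bullet> e \<le> t} = cbox 0 (1 + t *\<^sub>R e - e)"
    "cbox 0 (1 + t *\<^sub>R e) \<inter> {x. x \<bullet> e \<ge> t} = cbox (t *\<^sub>R e) (1 + t *\<^sub>R e)"
    using t by (auto simp: mem_box_cart ix en split: if_splits; (force | smt (verit)))+
  have "integral (cbox 0 1) h + integral (cbox e (1 + t *\<^sub>R e)) h = 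
        integral (cbox 0 (1 + t *\<^sub>R e - e)) h + integral (cbox (t *\<^sub>R e) (1 + t *\<^sub>R e)) h"
    using integral_split[OF int e, of 0 "1 + t *\<^sub>R e" 1] integral_split[OF int e, of 0 "1 + t *\<^sub>R e" t]
    by (simp add: box)
  moreover have "integral (cbox 0 (1 + t *\<^sub>R e - e)) h = integral (cbox e (1 + t *\<^sub>R e)) h"
    using integral_shift_cbox[of e e "1 + t *\<^sub>R e" h] torus_periodic_axis[OF h(1), of _ i] by (simp add: e_def)
  moreover have "integral (cbox 0 1) (\<lambda>x. h (x + t *\<^sub>R e)) = integral (cbox (t *\<^sub>R e) (1 + t *\<^sub>R e)) h"
    using integral_shift_cbox[of "t *\<^sub>R e" "t *\<^sub>R e" "1 + t *\<^sub>R e" h] by simp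
  ultimately show ?thesis by (simp add: e_def)
qed

text \<open>Partial derivatives are taken at time 0 with a varying base point; the Leibniz rule
  wants them at time \<open>t\<close> on a fixed line.\<close>

lemma has_vector_derivative_shift_line:
  fixes x v :: "'a::real_normed_vector" and h :: "'a \<Rightarrow> 'b::real_normed_vector"
  assumes "((\<lambda>s. h ((x + t *\<^sub>R v) + s *\<^sub>R v)) has_vector_derivative d) (at (0::real))"
  shows "((\<lambda>s. h (x + s *\<^sub>R v)) has_vector_derivative d) (at t)"
proof -
  have "((\<lambda>s. h ((x + t *\<^sub>R v) + s *\<^sub>R v)) \<circ> (\<lambda>s. s - t) has_vector_derivative 1 *\<^sub>R d) (at t)"
    by (rule vector_diff_chain_at) (use assms in \<open>auto intro!: derivative_eq_intros\<close>)
  moreover have "x + t *\<^sub>R v + (s - t) *\<^sub>R v = x + s *\<^sub>R v" for s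
    by (simp add: algebra_simps)
  ultimately show ?thesis by (simp add: o_def)
qed

text \<open>Integration by parts on the torus, free of boundary terms: the integral of a translate
  of \<open>h\<close> does not depend on the translation, and differentiating it under the integral
  sign gives the integral of \<open>h'\<close>.\<close>

lemma integral_periodic_derivative:
  fixes h :: "real ^ 'n \<Rightarrow> complex"
  assumes h: "torus_periodic h" "continuous_on UNIV h" and h': "continuous_on UNIV h'"
    and d: "\<And>x. ((\<lambda>t. h (x + t *\<^sub>R axis i 1)) has_vector_derivative h' x) (at 0)"
  shows "integral (cbox 0 1) h' = 0"
proof -
  have "((\<lambda>t. integral (cbox 0 1) (\<lambda>x. h (x + t *\<^sub>R axis i 1))) has_vector_derivative
      integral (cbox 0 1) (\<lambda>x. h' (x + 0 *\<^sub>R axis i 1))) (at 0 within {0..1})"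
  proof (rule leibniz_rule_vector_derivative)
    show "((\<lambda>t. h (x + t *\<^sub>R axis i 1)) has_vector_derivative h' (x + t *\<^sub>R axis i 1)) (at t within {0..1})" for t x
      by (rule has_vector_derivative_at_within[OF has_vector_derivative_shift_line[OF d]])
    show "(\<lambda>x. h (x + t *\<^sub>R axis i 1)) integrable_on cbox 0 1" for t
      by (intro integrable_continuous continuous_intros continuous_on_compose2[OF h(2)]) auto
    show "continuous_on ({0..1} \<times> cbox 0 1) (\<lambda>(t, x). h' (x + t *\<^sub>R axis i 1))"
      unfolding case_prod_unfold by (intro continuous_intros continuous_on_compose2[OF h']) auto
  qed auto
  \<comment> \<open>Translation invariance is available for \<open>t\<close> in [0,1], so the
    derivative at 0 is one-sided; it is still unique, as 0 is a limit point of that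
    interval.\<close>
  moreover have "((\<lambda>t. integral (cbox 0 1) (\<lambda>x. h (x + t *\<^sub>R axis i 1))) has_vector_derivative 0) (at 0 within {0..1})"
    by (rule has_vector_derivative_transform[where f = "\<lambda>_. integral (cbox 0 1) h"])
      (auto simp: integral_translate_axis[OF h])
  ultimately have "integral (cbox 0 1) (\<lambda>x. h' (x + 0 *\<^sub>R axis i 1)) = 0"
    by (rule vector_derivative_unique_within[rotated]) (simp add: trivial_limit_within)
  then show ?thesis by simp
qed

section \<open>Characters, Fourier coefficients and Bessel's inequality\<close>

definition character :: "int ^ 'n \<Rightarrow> real ^ 'n \<Rightarrow> complex" where
  "character l x = exp (2 * of_real pi * \<i> * of_real (lattice_vec l \<bullet> x))"

lemma character_add: "character (k + l) x = character k x * character l x"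
  by (simp add: character_def lattice_vec_add inner_add_left algebra_simps exp_add)

lemma cnj_character: "cnj (character l x) = character (- l) x"
  by (simp add: character_def lattice_vec_uminus exp_cnj)

lemma norm_character [simp]: "norm (character l x) = 1"
  by (simp add: character_def norm_exp_eq_Re)

lemma character_0 [simp]: "character 0 x = 1"
  by (simp add: character_def)

lemma continuous_on_character [continuous_intros]:
  "continuous_on A g \<Longrightarrow> continuous_on A (\<lambda>x. character l (g x))"
  unfolding character_def by (intro continuous_intros)

lemma torus_periodic_character: "torus_periodic (character l)"
proof -
  have "exp (2 * of_real pi * \<i> * of_real (lattice_vec l \<bullet> lattice_vec m)) = 1" for m
  proof -
    have "lattice_vec l \<bullet> lattice_vec m = of_int (\<Sum>i\<in>UNIV. l $ i * m $ i)"
      by (simp add: inner_vec_def)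
    then show ?thesis
      using exp_integer_2pi[of "of_int (\<Sum>i\<in>UNIV. l $ i * m $ i)"]
      by (metis Ints_of_int mult.assoc mult.commute of_real_of_int_eq of_real_mult of_real_numeral)
  qed
  then have "character l (x + lattice_vec m) = character l x" for x m
    by (simp add: character_def inner_add_right distrib_left exp_add)
  then show ?thesis by (simp add: torus_periodic_def)
qed

lemma has_vector_derivative_character:
  "((\<lambda>t. character l (x + t *\<^sub>R axis i 1)) has_vector_derivative
     2 * of_real pi * \<i> * of_int (l $ i) * character l x) (at 0)"
proof -
  define a where "a = 2 * of_real pi * \<i> * complex_of_int (l $ i)"
  have eq: "(\<lambda>t. character l (x + t *\<^sub>R axis i 1)) = (\<lambda>t. character l x * exp (a * of_real t))"
    by (rule ext) (simp add: character_def inner_add_right distrib_left exp_add a_def mult_ac)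
  have "((\<lambda>z. character l x * exp (a * z)) has_field_derivative character l x * a) (at (of_real 0))"
    by (auto intro!: derivative_eq_intros)
  then show ?thesis
    unfolding eq using has_vector_derivative_real_field by (fastforce simp: a_def mult_ac)
qed

text \<open>The pairing is with the character itself, not its conjugate, so this is the usual
  coefficient at \<open>- l\<close>. With this sign \<open>Op \<sigma>\<close> has the matrix
  entries \<open>fcoeff (k - m) (\<sigma> k)\<close>.\<close>

definition fcoeff :: "int ^ 'n \<Rightarrow> (real ^ 'n \<Rightarrow> complex) \<Rightarrow> complex" where
  "fcoeff l g = integral (cbox 0 1) (\<lambda>x. character l x * g x)"

lemma measure_unit_cube [simp]: "measure lborel (cbox 0 (1 :: real ^ 'n)) = 1"
proof -
  have "cbox 0 (1 :: real ^ 'n) \<noteq> {}" by (simp add: interval_ne_empty_cart)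
  then show ?thesis by (simp add: content_cbox_cart)
qed

text \<open>If \<open>l $ i\<close> is nonzero, the character is, up to a nonzero constant, the
  derivative of a periodic function.\<close>

lemma integral_character:
  "integral (cbox 0 1) (character (l :: int ^ 'n)) = (if l = 0 then 1 else 0)"
proof (cases "l = 0")
  case True
  have "character (0 :: int ^ 'n) = (\<lambda>_. 1)" by auto
  then show ?thesis using True by simp
next
  case False
  then obtain i where i: "l $ i \<noteq> 0" by (auto simp: vec_eq_iff)
  have "integral (cbox 0 1) (\<lambda>x. 2 * of_real pi * \<i> * of_int (l $ i) * character l x) = 0"
    by (rule integral_periodic_derivative[OF torus_periodic_character _ _ has_vector_derivative_character])
      (intro continuous_intros)+
  then show ?thesis using i False by simp
qed

text \<open>With \<open>S\<close> the left-hand side and \<open>P\<close> the conjugate of the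
  partial Fourier sum of \<open>g\<close>, both the integral of \<open>g * P\<close> and that of the
  squared modulus of \<open>P\<close> equal \<open>S\<close>. The arithmetic-geometric mean
  inequality then gives \<open>S \<le> (M\<^sup>2 + S) / 2\<close>, into which the sup bound
  \<open>M\<close> enters directly.\<close>

lemma bessel:
  fixes g :: "real ^ 'n \<Rightarrow> complex"
  assumes g: "continuous_on UNIV g" and M: "\<And>x. norm (g x) \<le> M" and F: "finite F"
  shows "(\<Sum>l\<in>F. (norm (fcoeff l g))\<^sup>2) \<le> M\<^sup>2"
proof -
  define S where "S = (\<Sum>l\<in>F. (norm (fcoeff l g))\<^sup>2)"
  define P where "P x = (\<Sum>l\<in>F. cnj (fcoeff l g) * character l x)" for x
  have cP: "continuous_on A P" for A unfolding P_def by (intro continuous_intros)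
  have cg: "continuous_on A g" for A using g continuous_on_subset by blast
  have ig: "(\<lambda>x. c * (character l x * g x)) integrable_on cbox 0 1" for l c
    by (intro integrable_continuous continuous_intros cg)
  have gP: "integral (cbox 0 1) (\<lambda>x. g x * P x) = of_real S"
  proof -
    have "integral (cbox 0 1) (\<lambda>x. g x * P x) =
        integral (cbox 0 1) (\<lambda>x. \<Sum>l\<in>F. cnj (fcoeff l g) * (character l x * g x))"
      by (simp add: P_def sum_distrib_left mult_ac)
    also have "\<dots> = (\<Sum>l\<in>F. cnj (fcoeff l g) * fcoeff l g)"
      by (subst integral_sum) (simp_all add: F ig fcoeff_def)
    also have "\<dots> = of_real S"
      by (simp add: S_def complex_norm_square mult.commute del: of_real_power)
    finally show ?thesis .
  qed
  have PP: "integral (cbox 0 1) (\<lambda>x. (norm (P x))\<^sup>2) = S"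
  proof -
    have "complex_of_real ((norm (P x))\<^sup>2) = 
        (\<Sum>l\<in>F. \<Sum>m\<in>F. cnj (fcoeff l g) * fcoeff m g * character (l - m) x)" for x
      unfolding complex_norm_square P_def cnj_sum sum_product
      by (simp add: cnj_character character_add[of _ "- _", simplified] mult_ac)
    then have "integral (cbox 0 1) (\<lambda>x. complex_of_real ((norm (P x))\<^sup>2)) =
        integral (cbox 0 1) (\<lambda>x. \<Sum>l\<in>F. \<Sum>m\<in>F. cnj (fcoeff l g) * fcoeff m g * character (l - m) x)"
      by simp
    \<comment> \<open>Orthogonality of the characters leaves only the diagonal.\<close>
    also have "\<dots> = (\<Sum>l\<in>F. \<Sum>m\<in>F. cnj (fcoeff l g) * fcoeff m g * (if l = m then 1 else 0))"
      by (subst integral_sum F | simp add: F integral_character integrable_continuous continuous_intros)+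
    also have "\<dots> = of_real S"
      by (simp add: S_def complex_norm_square mult.commute F if_distrib cong: if_cong del: of_real_power)
    finally have "integral (cbox 0 1) (\<lambda>x. complex_of_real ((norm (P x))\<^sup>2)) = of_real S" .
    moreover have "(\<lambda>x. (norm (P x))\<^sup>2) integrable_on cbox 0 1"
      by (intro integrable_continuous continuous_intros cP)
    ultimately show ?thesis
      using integral_linear[of "\<lambda>x. (norm (P x))\<^sup>2" "cbox 0 1" complex_of_real] bounded_linear_of_real[where 'a=complex]
      by (simp add: o_def del: of_real_power)
  qed
  have "S = norm (integral (cbox 0 1) (\<lambda>x. g x * P x))"
    unfolding gP norm_of_real by (simp add: S_def sum_nonneg)
  also have "\<dots> \<le> integral (cbox 0 1) (\<lambda>x. (M\<^sup>2 + (norm (P x))\<^sup>2) / 2)"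
  proof (rule integral_norm_bound_integral)
    show "(\<lambda>x. g x * P x) integrable_on cbox 0 1" "(\<lambda>x. (M\<^sup>2 + (norm (P x))\<^sup>2) / 2) integrable_on cbox 0 1"
      by (intro integrable_continuous continuous_intros cP cg; simp)+
    fix x
    have "norm (g x * P x) \<le> M * norm (P x)" by (simp add: norm_mult M mult_right_mono)
    also have "\<dots> \<le> (M\<^sup>2 + (norm (P x))\<^sup>2) / 2"
      using sum_squares_bound[of M "norm (P x)"] by simp
    finally show "norm (g x * P x) \<le> (M\<^sup>2 + (norm (P x))\<^sup>2) / 2" .
  qed
  also have "\<dots> = (M\<^sup>2 + S) / 2"
    by (simp add: integral_add integrable_continuous continuous_intros cP PP)
  finally show ?thesis by (simp add: S_def)
qed


section \<open>Derivatives on the Fourier side\<close>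

lemma cont_diff_torus_continuous: "cont_diff_torus m g \<Longrightarrow> continuous_on UNIV g"
  by (cases m) (auto simp: cont_diff_torus_def)

lemma torus_periodic_partial: "torus_periodic g \<Longrightarrow> torus_periodic (partial i g)"
proof -
  assume g: "torus_periodic g"
  have "g (x + lattice_vec m + t *\<^sub>R axis i 1) = g (x + t *\<^sub>R axis i 1)" for x m t
    using g unfolding torus_periodic_def by (metis add.assoc add.commute)
  then show ?thesis by (simp add: torus_periodic_def partial_def)
qed

lemma cont_diff_torus_partial:
  "cont_diff_torus (Suc m) g \<Longrightarrow> cont_diff_torus m (partial i g)"
  by (simp add: cont_diff_torus_def torus_periodic_partial)

text \<open>The product \<open>character l x * g x\<close> is periodic, so its derivative integrates
  to zero; the product rule splits that integral into the two sides.\<close>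

lemma fcoeff_partial:
  assumes g: "cont_diff_torus (Suc m) g"
  shows "fcoeff l (partial i g) = - (2 * of_real pi * \<i> * of_int (l $ i)) * fcoeff l g"
proof -
  define a where "a = 2 * of_real pi * \<i> * complex_of_int (l $ i)"
  have cg: "continuous_on A g" for A
    using cont_diff_torus_continuous[OF g] continuous_on_subset by blast
  have cp: "continuous_on A (partial i g)" for A
    using cont_diff_torus_continuous[OF cont_diff_torus_partial[OF g]] continuous_on_subset by blast
  have dg: "((\<lambda>t. g (x + t *\<^sub>R axis i 1)) has_vector_derivative partial i g x) (at 0)" for x
    using g unfolding partial_def by (auto simp: cont_diff_torus_def intro: vector_derivative_works[THEN iffD1])
  have "integral (cbox 0 1) (\<lambda>x. a * (character l x * g x) + character l x * partial i g x) = 0"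
  proof (rule integral_periodic_derivative[where h = "\<lambda>x. character l x * g x" and i = i])
    show "torus_periodic (\<lambda>x. character l x * g x)"
      using torus_periodic_character[of l] g by (simp add: torus_periodic_def cont_diff_torus_def)
    show "((\<lambda>t. character l (x + t *\<^sub>R axis i 1) * g (x + t *\<^sub>R axis i 1)) has_vector_derivative
           a * (character l x * g x) + character l x * partial i g x) (at 0)" for x
      using has_vector_derivative_mult[OF has_vector_derivative_character[of l x i] dg[of x]]
      by (simp add: a_def algebra_simps)
  qed (intro continuous_intros cg cp)+
  moreover have "integral (cbox 0 1) (\<lambda>x. a * (character l x * g x) + character l x * partial i g x) 
      = a * fcoeff l g + fcoeff l (partial i g)"
    unfolding fcoeff_def
    by (subst integral_add) (simp_all add: integrable_continuous continuous_intros cg cp)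
  ultimately show ?thesis by (simp add: a_def eq_neg_iff_add_eq_0 add.commute)
qed

text \<open>Continuity of the last derivative is carried along because \<open>bessel\<close> will be
  applied to it.\<close>

lemma fcoeff_partial_funpow:
  "cont_diff_torus m g \<Longrightarrow>
    cont_diff_torus 0 ((partial i ^^ m) g) \<and> 
    fcoeff l ((partial i ^^ m) g) = (- (2 * of_real pi * \<i> * of_int (l $ i))) ^ m * fcoeff l g"
proof (induction m arbitrary: g)
  case (Suc m)
  from Suc.IH[OF cont_diff_torus_partial[OF Suc.prems, of i]] fcoeff_partial[OF Suc.prems, of l i]
  \<comment> \<open>The innermost derivative is peeled off: \<open>partial i g\<close> has one order
    of smoothness less, which matches the induction hypothesis.\<close>
  show ?case by (simp add: funpow_Suc_right del: funpow.simps)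
qed simp

lemma coord_enum: "distinct (coord_enum :: 'n::finite list)" "set (coord_enum :: 'n list) = UNIV"
  using someI_ex[OF finite_distinct_list[OF finite[of "UNIV :: 'n set"]]]
  by (auto simp: coord_enum_def conj_commute)

lemma multi_partial_0 [simp]: "multi_partial (\<lambda>_. 0) g = g"
proof -
  have "foldr (\<lambda>i. partial i ^^ 0) is g = g" for "is" by (induction "is") auto
  then show ?thesis by (simp add: multi_partial_def)
qed

text \<open>Links the multi-index bounds to the iterates of a single \<open>partial i\<close>. As
  the enumeration is distinct and exhaustive, the fold meets \<open>i\<close> exactly once.\<close>

lemma multi_partial_single: "multi_partial (\<lambda>j. if j = i then m else 0) g = (partial i ^^ m) g"
proof -
  have "distinct is \<Longrightarrow> foldr (\<lambda>j. partial j ^^ (if j = i then m else 0)) is g =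
      (if i \<in> set is then (partial i ^^ m) g else g)" for "is" :: "'a list"
    by (induction "is") auto
  then show ?thesis by (simp add: multi_partial_def coord_enum)
qed

section \<open>The weight: a weighted Bessel inequality and summability of the reciprocal\<close>

definition lattice_weight :: "nat \<Rightarrow> int ^ 'n \<Rightarrow> real" where
  "lattice_weight m l = 1 + (\<Sum>i\<in>UNIV. \<bar>of_int (l $ i)\<bar> ^ (2 * m))"

lemma lattice_weight_ge_1: "1 \<le> lattice_weight m l"
  by (simp add: lattice_weight_def sum_nonneg)

text \<open>Each term of the weight is handled by one use of \<open>bessel\<close>: the 1 by
  \<open>g\<close> itself, the power of coordinate \<open>i\<close> by the pure derivative of order
  \<open>m\<close> in direction \<open>i\<close>. This makes \<open>1 + CARD('n)\<close>
  contributions of at most \<open>C\<^sup>2\<close>.\<close>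

lemma weighted_bessel:
  fixes g :: "real ^ 'n \<Rightarrow> complex"
  assumes g: "cont_diff_torus m g" and F: "finite F"
    and C: "\<And>\<beta> x. sum \<beta> UNIV \<le> m \<Longrightarrow> norm (multi_partial \<beta> g x) \<le> C"
  shows "(\<Sum>l\<in>F. lattice_weight m l * (norm (fcoeff l g))\<^sup>2) \<le> (1 + real CARD('n)) * C\<^sup>2"
proof -
  have 0: "(\<Sum>l\<in>F. (norm (fcoeff l g))\<^sup>2) \<le> C\<^sup>2"
    using C[of "\<lambda>_. 0"] by (intro bessel cont_diff_torus_continuous[OF g] F) auto
  have i: "(\<Sum>l\<in>F. \<bar>of_int (l $ i)\<bar> ^ (2 * m) * (norm (fcoeff l g))\<^sup>2) \<le> C\<^sup>2" for i
  proof -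
    let ?D = "(partial i ^^ m) g"
    have "\<bar>of_int (l $ i)\<bar> ^ (2 * m) * (norm (fcoeff l g))\<^sup>2 \<le> (norm (fcoeff l ?D))\<^sup>2" for l
    proof -
      \<comment> \<open>The factor \<open>2 * pi\<close> produced by differentiation is at least 1
        and is dropped.\<close>
      have "\<bar>of_int (l $ i)\<bar> \<le> norm (- (2 * of_real pi * \<i> * complex_of_int (l $ i)))"
        using pi_ge_two by (simp add: norm_mult mult_le_cancel_right1)
      then have "\<bar>of_int (l $ i)\<bar> ^ (2 * m) \<le> norm (- (2 * of_real pi * \<i> * complex_of_int (l $ i))) ^ (2 * m)"
        by (rule power_mono) simp
      then show ?thesis
        using fcoeff_partial_funpow[OF g, of i l]
        by (simp add: norm_mult norm_power power_mult_distrib mult_right_mono flip: power_mult add: mult.commute[of m])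
    qed
    then have "(\<Sum>l\<in>F. \<bar>of_int (l $ i)\<bar> ^ (2 * m) * (norm (fcoeff l g))\<^sup>2) \<le> (\<Sum>l\<in>F. (norm (fcoeff l ?D))\<^sup>2)"
      by (intro sum_mono)
    also have "\<dots> \<le> C\<^sup>2"
      using C[of "\<lambda>j. if j = i then m else 0"] fcoeff_partial_funpow[OF g, of i]
      by (intro bessel cont_diff_torus_continuous F) (auto simp: multi_partial_single)
    finally show ?thesis .
  qed
  have "(\<Sum>l\<in>F. lattice_weight m l * (norm (fcoeff l g))\<^sup>2) = (\<Sum>l\<in>F. (norm (fcoeff l g))\<^sup>2) +
      (\<Sum>i\<in>UNIV. \<Sum>l\<in>F. \<bar>of_int (l $ i)\<bar> ^ (2 * m) * (norm (fcoeff l g))\<^sup>2)"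
    by (subst sum.swap) (simp add: lattice_weight_def distrib_right sum.distrib sum_distrib_right)
  also have "\<dots> \<le> C\<^sup>2 + (\<Sum>i\<in>(UNIV :: 'n set). C\<^sup>2)"
    by (intro add_mono 0 sum_mono i)
  finally show ?thesis by (simp add: distrib_right)
qed

text \<open>The absolute value is injective on the nonnegative and on the negative integers; each
  half contributes at most one \<open>suminf v\<close>.\<close>

lemma sum_int_abs_bounded:
  assumes v: "summable v" "\<And>m. 0 \<le> v m" and J: "finite J"
  shows "(\<Sum>j\<in>J. v (nat \<bar>j\<bar>)) \<le> 2 * suminf (v :: nat \<Rightarrow> real)"
proof -
  have part: "(\<Sum>j\<in>J'. v (nat \<bar>j\<bar>)) \<le> suminf v"
    if "inj_on (\<lambda>j. nat \<bar>j\<bar>) J'" "finite J'" for J' :: "int set"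
    using sum_le_suminf[OF v(1), of "(\<lambda>j. nat \<bar>j\<bar>) ` J'"] v(2) that by (simp add: sum.reindex)
  have "(\<Sum>j\<in>J. v (nat \<bar>j\<bar>)) = (\<Sum>j\<in>J \<inter> {0..}. v (nat \<bar>j\<bar>)) + (\<Sum>j\<in>J - {0..}. v (nat \<bar>j\<bar>))"
    using J by (rule sum.Int_Diff)
  also have "\<dots> \<le> suminf v + suminf v"
    by (intro add_mono part) (auto simp: inj_on_def J)
  finally show ?thesis by simp
qed

text \<open>Reduction to one dimension: the weight dominates
  \<open>1 + \<bar>l $ i\<bar> ^ (2 * m)\<close> for every \<open>i\<close>, so writing its
  reciprocal as a product of \<open>n\<close> equal roots bounds it by a product of functions of
  single coordinates. Each factor decays with exponent \<open>2 * m / n > 1\<close>.\<close>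

lemma lattice_weight_summable:
  assumes m: "real m > real CARD('n) / 2"
  shows "(\<lambda>l :: int ^ 'n. 1 / lattice_weight m l) summable_on UNIV"
proof -
  define n where "n = real CARD('n)"
  have n: "n > 0" by (simp add: n_def)
  define v :: "nat \<Rightarrow> real" where "v j = (1 + real j ^ (2 * m)) powr (- 1 / n)" for j
  have v0: "0 \<le> v j" for j by (simp add: v_def)
  have "summable v"
  proof (rule summable_comparison_test_ev)
    show "summable (\<lambda>j. real j powr (- (2 * m / n)))"
      using m n by (subst summable_real_powr_iff) (simp add: n_def field_simps)
    show "\<forall>\<^sub>F j in sequentially. norm (v j) \<le> real j powr (- (2 * m / n))"
      \<comment> \<open>The comparison fails at \<open>j = 0\<close>, where \<open>v 0 = 1\<close>
        but \<open>0 powr _\<close> is 0.\<close>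
      using eventually_gt_at_top[of 0]
    proof eventually_elim
      case (elim j)
      have "v j \<le> (real j ^ (2 * m)) powr (- 1 / n)"
        unfolding v_def using elim n by (intro powr_mono2') auto
      also have "\<dots> = real j powr (- (2 * m / n))"
        using elim by (simp add: powr_powr flip: powr_realpow)
      finally show ?case using v0 by simp
    qed
  qed
  note v = this v0
  have w: "1 / lattice_weight m l \<le> (\<Prod>i\<in>UNIV. v (nat \<bar>l $ i\<bar>))" for l :: "int ^ 'n"
  proof -
    let ?w = "lattice_weight m l"
    have w0: "?w > 0" using lattice_weight_ge_1[of m l] by simp
    have "(?w powr (- 1 / n)) ^ CARD('n) = ?w powr - 1"
      using w0 by (simp add: powr_power n_def)
    then have "1 / ?w = (\<Prod>i\<in>(UNIV :: 'n set). ?w powr (- 1 / n))"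
      using w0 by (simp add: powr_minus_divide)
    also have "\<dots> \<le> (\<Prod>i\<in>UNIV. v (nat \<bar>l $ i\<bar>))"
    proof (intro prod_mono conjI)
      fix i
      have "\<bar>of_int (l $ i)\<bar> ^ (2 * m) \<le> (\<Sum>i\<in>UNIV. \<bar>real_of_int (l $ i)\<bar> ^ (2 * m))"
        by (rule member_le_sum) auto
      then have "1 + real (nat \<bar>l $ i\<bar>) ^ (2 * m) \<le> ?w"
        by (simp add: lattice_weight_def)
      then show "?w powr (- 1 / n) \<le> v (nat \<bar>l $ i\<bar>)"
        unfolding v_def using n by (intro powr_mono2') (auto intro: add_pos_nonneg)
    qed simp
    finally show ?thesis .
  qed
  show ?thesis
  proof (rule nonneg_bounded_partial_sums_imp_summable_on)
    show "\<forall>\<^sub>F F in finite_subsets_at_top UNIV. 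
        (\<Sum>l\<in>F. 1 / lattice_weight m (l :: int ^ 'n)) \<le> (2 * suminf v) ^ CARD('n)"
    proof (rule eventually_finite_subsets_at_top_weakI)
      fix F :: "(int ^ 'n) set" assume F: "finite F"
      \<comment> \<open>All coordinates of points of \<open>F\<close> lie in \<open>J\<close>, so
        \<open>F\<close> embeds into the functions with values in \<open>J\<close>, over which the
        sum of products factorises.\<close>
      define J where "J = (\<Union>i\<in>UNIV. (\<lambda>l. l $ i) ` F)"
      have J: "finite J" using F by (simp add: J_def)
      have "(\<Sum>l\<in>F. 1 / lattice_weight m l) \<le> (\<Sum>l\<in>F. \<Prod>i\<in>UNIV. v (nat \<bar>l $ i\<bar>))"
        by (intro sum_mono w)
      also have "\<dots> = (\<Sum>h\<in>vec_nth ` F. \<Prod>i\<in>UNIV. v (nat \<bar>h i\<bar>))"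
        by (subst sum.reindex) (auto simp: inj_on_def vec_nth_inject)
      also have "\<dots> \<le> (\<Sum>h\<in>PiE (UNIV :: 'n set) (\<lambda>_. J). \<Prod>i\<in>UNIV. v (nat \<bar>h i\<bar>))"
        by (rule sum_mono2) (auto simp: J J_def finite_PiE v prod_nonneg F)
      also have "\<dots> = (\<Prod>i\<in>(UNIV :: 'n set). \<Sum>j\<in>J. v (nat \<bar>j\<bar>))"
        by (subst prod_sum_PiE) (auto simp: J)
      also have "\<dots> = (\<Sum>j\<in>J. v (nat \<bar>j\<bar>)) ^ CARD('n)" by simp
      also have "\<dots> \<le> (2 * suminf v) ^ CARD('n)"
        by (intro power_mono sum_int_abs_bounded sum_nonneg v J)
      finally show "(\<Sum>l\<in>F. 1 / lattice_weight m l) \<le> (2 * suminf v) ^ CARD('n)" .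
    qed
  qed (use lattice_weight_ge_1 in \<open>auto intro: order_trans[OF zero_le_one]\<close>)
qed

section \<open>Infinite matrices bounded on the square-summable functions\<close>

lemma has_sum_sum:
  fixes f :: "'a \<Rightarrow> 'b \<Rightarrow> 'c::topological_comm_monoid_add"
  assumes "\<And>k. k \<in> F \<Longrightarrow> (f k has_sum s k) A"
  shows "((\<lambda>m. \<Sum>k\<in>F. f k m) has_sum (\<Sum>k\<in>F. s k)) A"
  using assms by (induction F rule: infinite_finite_induct) (auto intro!: has_sum_add)

text \<open>A weighted Schur test. Cauchy-Schwarz with weight \<open>p k\<close> bounds the squared
  value at \<open>k\<close> by \<open>D\<close> times the sum of
  \<open>(norm (f m))\<^sup>2 / p k m\<close>; summing over \<open>k\<close> and using the column
  bound gives the operator norm bound \<open>sqrt (D * W)\<close>.\<close>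

lemma bounded_operator_ell2_kernel:
  fixes K :: "'a \<Rightarrow> 'a \<Rightarrow> complex" and p :: "'a \<Rightarrow> 'a \<Rightarrow> real"
  assumes p: "\<And>k m. 0 < p k m"
    and row: "\<And>k F. finite F \<Longrightarrow> (\<Sum>m\<in>F. p k m * (norm (K k m))\<^sup>2) \<le> D"
    and col: "\<And>m F. finite F \<Longrightarrow> (\<Sum>k\<in>F. 1 / p k m) \<le> W"
  shows "bounded_operator_ell2 (\<lambda>f k. \<Sum>\<^sub>\<infinity>m. K k m * f m)"
proof -
  have D0: "0 \<le> D" and W0: "0 \<le> W" using row[of "{}"] col[of "{}"] by auto
  have abs: "(\<lambda>m. norm (K k m * f m)) summable_on UNIV" (is ?A)
    and bound: "(norm (\<Sum>\<^sub>\<infinity>m. K k m * f m))\<^sup>2 \<le> D * (\<Sum>\<^sub>\<infinity>m. (norm (f m))\<^sup>2 / p k m)" (is ?B)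
    and sum: "(\<lambda>m. (norm (f m))\<^sup>2 / p k m) summable_on UNIV" (is ?C)
    if f: "f \<in> ell2" for f k
  proof -
    show C: ?C
    proof (rule summable_on_comparison_test)
      show "(\<lambda>m. W * (norm (f m))\<^sup>2) summable_on UNIV"
        using f by (intro summable_on_cmult_right) (simp add: ell2_def)
      \<comment> \<open>The column bound for the singleton \<open>{k}\<close> says
        \<open>1 / p k m \<le> W\<close>.\<close>
      show "(norm (f m))\<^sup>2 / p k m \<le> W * (norm (f m))\<^sup>2" for m
        using col[of "{k}" m] mult_right_mono[of "1 / p k m" W "(norm (f m))\<^sup>2"] by simp
    qed (use p less_imp_le in \<open>auto intro!: divide_nonneg_nonneg\<close>)
    define R where "R = D * (\<Sum>\<^sub>\<infinity>m. (norm (f m))\<^sup>2 / p k m)"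
    have R0: "0 \<le> R"
      unfolding R_def by (intro mult_nonneg_nonneg infsum_nonneg divide_nonneg_nonneg D0 less_imp_le[OF p]) auto
    have fin: "(\<Sum>m\<in>F. norm (K k m * f m)) \<le> sqrt R" if F: "finite F" for F
    proof (rule real_le_rsqrt)
      have "(\<Sum>m\<in>F. norm (K k m * f m))\<^sup>2 =
          (\<Sum>m\<in>F. (sqrt (p k m) * norm (K k m)) * (norm (f m) / sqrt (p k m)))\<^sup>2"
        using p by (simp add: norm_mult less_imp_neq[THEN not_sym])
      also have "\<dots> \<le> (\<Sum>m\<in>F. (sqrt (p k m) * norm (K k m))\<^sup>2) * (\<Sum>m\<in>F. (norm (f m) / sqrt (p k m))\<^sup>2)"
        by (rule Cauchy_Schwarz_ineq_sum)
      also have "\<dots> = (\<Sum>m\<in>F. p k m * (norm (K k m))\<^sup>2) * (\<Sum>m\<in>F. (norm (f m))\<^sup>2 / p k m)"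
        using p by (simp add: power_mult_distrib power_divide less_imp_le)
      also have "\<dots> \<le> R"
        unfolding R_def
        by (intro mult_mono row F finite_sum_le_infsum C D0 sum_nonneg divide_nonneg_nonneg less_imp_le[OF p]) auto
      finally show "(\<Sum>m\<in>F. norm (K k m * f m))\<^sup>2 \<le> R" .
    qed
    show A: ?A
      by (rule nonneg_bounded_partial_sums_imp_summable_on[where C = "sqrt R"])
        (auto intro!: eventually_finite_subsets_at_top_weakI fin)
    have "norm (\<Sum>\<^sub>\<infinity>m. K k m * f m) \<le> (\<Sum>\<^sub>\<infinity>m. norm (K k m * f m))"
      using A by (rule norm_infsum_bound)
    also have "\<dots> \<le> sqrt R" using A by (rule infsum_le_finite_sums) (rule fin)
    finally have "(norm (\<Sum>\<^sub>\<infinity>m. K k m * f m))\<^sup>2 \<le> (sqrt R)\<^sup>2" by (rule power_mono) simp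
    then show ?B using R0 by (simp add: R_def)
  qed
  \<comment> \<open>Additivity of the operator rests on this: \<open>infsum\<close> is 0 on families
    that are not summable, so it is not additive in general.\<close>
  note summ = abs_summable_summable[OF abs]
  have fin: "(\<Sum>k\<in>F. (norm (\<Sum>\<^sub>\<infinity>m. K k m * f m))\<^sup>2) \<le> D * W * (\<Sum>\<^sub>\<infinity>m. (norm (f m))\<^sup>2)"
    if f: "f \<in> ell2" and F: "finite F" for f F
  proof -
    have f2: "(\<lambda>m. W * (norm (f m))\<^sup>2) summable_on UNIV"
      using f by (intro summable_on_cmult_right) (simp add: ell2_def)
    \<comment> \<open>With \<open>k\<close> confined to a finite set, exchanging the two sums takes
      only additivity of \<open>has_sum\<close>.\<close>
    have "((\<lambda>m. \<Sum>k\<in>F. (norm (f m))\<^sup>2 / p k m) has_sum (\<Sum>k\<in>F. \<Sum>\<^sub>\<infinity>m. (norm (f m))\<^sup>2 / p k m)) UNIV"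
      by (intro has_sum_sum has_sum_infsum sum f)
    then have *: "(\<Sum>k\<in>F. \<Sum>\<^sub>\<infinity>m. (norm (f m))\<^sup>2 / p k m) \<le> (\<Sum>\<^sub>\<infinity>m. W * (norm (f m))\<^sup>2)"
    proof (rule has_sum_mono[OF _ has_sum_infsum[OF f2]])
      fix m
      have "(\<Sum>k\<in>F. (norm (f m))\<^sup>2 / p k m) = (\<Sum>k\<in>F. 1 / p k m) * (norm (f m))\<^sup>2"
        by (simp add: sum_distrib_right)
      also have "\<dots> \<le> W * (norm (f m))\<^sup>2"
        by (intro mult_right_mono col F) simp
      finally show "(\<Sum>k\<in>F. (norm (f m))\<^sup>2 / p k m) \<le> W * (norm (f m))\<^sup>2" .
    qed
    have "(\<Sum>k\<in>F. (norm (\<Sum>\<^sub>\<infinity>m. K k m * f m))\<^sup>2) \<le> (\<Sum>k\<in>F. D * (\<Sum>\<^sub>\<infinity>m. (norm (f m))\<^sup>2 / p k m))"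
      by (intro sum_mono bound f)
    also have "\<dots> = D * (\<Sum>k\<in>F. \<Sum>\<^sub>\<infinity>m. (norm (f m))\<^sup>2 / p k m)"
      by (simp add: sum_distrib_left)
    also have "\<dots> \<le> D * (\<Sum>\<^sub>\<infinity>m. W * (norm (f m))\<^sup>2)"
      using * D0 by (rule mult_left_mono)
    finally show ?thesis by (simp add: infsum_cmult_right' mult.assoc)
  qed
  have mem: "(\<lambda>k. \<Sum>\<^sub>\<infinity>m. K k m * f m) \<in> ell2" if f: "f \<in> ell2" for f
    unfolding ell2_def mem_Collect_eq
    by (rule nonneg_bounded_partial_sums_imp_summable_on)
      (auto intro!: eventually_finite_subsets_at_top_weakI fin[OF f])
  show ?thesis
    unfolding bounded_operator_ell2_def
  proof (intro conjI ballI allI exI)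
    fix f g :: "'a \<Rightarrow> complex" and c assume f: "f \<in> ell2"
    show "(\<lambda>k. \<Sum>\<^sub>\<infinity>m. K k m * f m) \<in> ell2" by (rule mem[OF f])
    show "(\<lambda>k. \<Sum>\<^sub>\<infinity>m. K k m * (c * f m)) = (\<lambda>k. c * (\<Sum>\<^sub>\<infinity>m. K k m * f m))"
      by (simp add: infsum_cmult_right' mult.left_commute)
    assume g: "g \<in> ell2"
    show "(\<lambda>k. \<Sum>\<^sub>\<infinity>m. K k m * (f m + g m)) = (\<lambda>k. (\<Sum>\<^sub>\<infinity>m. K k m * f m) + (\<Sum>\<^sub>\<infinity>m. K k m * g m))"
      by (simp add: distrib_left infsum_add summ f g)
  next
    fix f :: "'a \<Rightarrow> complex" assume f: "f \<in> ell2"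
    have "(\<Sum>\<^sub>\<infinity>k. (norm (\<Sum>\<^sub>\<infinity>m. K k m * f m))\<^sup>2) \<le> D * W * (\<Sum>\<^sub>\<infinity>m. (norm (f m))\<^sup>2)"
      using mem[OF f] unfolding ell2_def mem_Collect_eq
      by (rule infsum_le_finite_sums) (rule fin[OF f])
    then show "ell2_norm (\<lambda>k. \<Sum>\<^sub>\<infinity>m. K k m * f m) \<le> sqrt (D * W) * ell2_norm f"
      unfolding ell2_norm_def real_sqrt_mult[symmetric] by (rule real_sqrt_le_mono)
  qed
qed

section \<open>\<open>Op \<sigma>\<close> as an infinite matrix\<close>

lemma rapidly_decreasing_abs_summable:
  fixes f :: "int ^ 'n \<Rightarrow> complex"
  assumes f: "rapidly_decreasing f"
  shows "(\<lambda>k. norm (f k)) summable_on UNIV"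
proof -
  \<comment> \<open>A convenient exponent above half the dimension: decay of order
    \<open>2 * m\<close> then beats \<open>lattice_weight m\<close>, whose reciprocal is
    summable.\<close>
  define m where "m = CARD('n)"
  have m: "real m > real CARD('n) / 2" by (simp add: m_def)
  obtain A where A: "(1 + norm (lattice_vec k)) ^ (2 * m) * norm (f k) \<le> A" for k
    using f unfolding rapidly_decreasing_def by blast
  show ?thesis
  proof (rule summable_on_comparison_test)
    show "(\<lambda>k. (1 + real CARD('n)) * A * (1 / lattice_weight m k)) summable_on (UNIV :: (int ^ 'n) set)"
      by (intro summable_on_cmult_right lattice_weight_summable m)
    fix k :: "int ^ 'n"
    let ?N = "1 + norm (lattice_vec k)"
    have "\<bar>of_int (k $ i)\<bar> ^ (2 * m) \<le> ?N ^ (2 * m)" for i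
      using component_le_norm_cart[of "lattice_vec k" i] by (intro power_mono) auto
    then have "lattice_weight m k \<le> ?N ^ (2 * m) + (\<Sum>i\<in>(UNIV :: 'n set). ?N ^ (2 * m))"
      unfolding lattice_weight_def by (intro add_mono sum_mono one_le_power) auto
    then have "lattice_weight m k \<le> (1 + real CARD('n)) * ?N ^ (2 * m)"
      by (simp add: distrib_right)
    then have "lattice_weight m k * norm (f k) \<le> (1 + real CARD('n)) * ?N ^ (2 * m) * norm (f k)"
      by (rule mult_right_mono) simp
    also have "\<dots> \<le> (1 + real CARD('n)) * A"
      unfolding mult.assoc by (intro mult_left_mono A) auto
    finally show "norm (f k) \<le> (1 + real CARD('n)) * A * (1 / lattice_weight m k)"
      using lattice_weight_ge_1[of m k] by (simp add: field_simps)
  qed auto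
qed

text \<open>Absolute summability of \<open>f\<close> makes its Fourier series converge uniformly, so
  it may be multiplied by a bounded function and integrated term by term; the characters of
  \<open>k\<close> and \<open>- m\<close> combine to that of \<open>k - m\<close>.\<close>

lemma Op_eq_kernel:
  fixes f :: "int ^ 'n \<Rightarrow> complex"
  assumes f: "(\<lambda>k. norm (f k)) summable_on UNIV" and g: "continuous_on UNIV (\<sigma> k)"
  shows "Op \<sigma> f k = (\<Sum>\<^sub>\<infinity>m. fcoeff (k - m) (\<sigma> k) * f m)"
proof -
  have cg: "continuous_on A (\<sigma> k)" for A using g continuous_on_subset by blast
  have lf: "lattice_fourier f x = (\<Sum>\<^sub>\<infinity>m. character (- m) x * f m)" for x
    unfolding lattice_fourier_def character_def by (simp add: lattice_vec_uminus)
  have U: "uniform_limit (cbox 0 1) (\<lambda>F x. \<Sum>m\<in>F. character (- m) x * f m) (lattice_fourier f) (finite_subsets_at_top UNIV)"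
    unfolding lf by (rule Weierstrass_m_test_general[OF _ f]) (simp add: norm_mult)
  have cf: "continuous_on (cbox 0 1) (lattice_fourier f)"
    by (rule uniform_limit_theorem[OF always_eventually U]) (auto intro!: continuous_intros)
  have bdd: "bounded ((\<lambda>x. character k x * \<sigma> k x) ` cbox 0 1)" "bounded (lattice_fourier f ` cbox 0 1)"
    by (intro compact_imp_bounded compact_continuous_image continuous_intros cg cf compact_cbox)+
  have "uniform_limit (cbox 0 1) (\<lambda>F x. (character k x * \<sigma> k x) * (\<Sum>m\<in>F. character (- m) x * f m)) 
      (\<lambda>x. (character k x * \<sigma> k x) * lattice_fourier f x) (finite_subsets_at_top UNIV)"
    by (intro uniform_lim_mult U uniform_limit_const bdd)
  then obtain I J where I: "\<And>F. ((\<lambda>x. (character k x * \<sigma> k x) * (\<Sum>m\<in>F. character (- m) x * f m)) has_integral I F) (cbox 0 1)"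
    and J: "((\<lambda>x. (character k x * \<sigma> k x) * lattice_fourier f x) has_integral J) (cbox 0 1)"
    and lim: "(I \<longlongrightarrow> J) (finite_subsets_at_top UNIV)"
    by (rule uniform_limit_integral_cbox) (auto intro!: continuous_intros cg)
  have "I F = (\<Sum>m\<in>F. fcoeff (k - m) (\<sigma> k) * f m)" for F
  proof (cases "finite F")
    case True
    have "I F = integral (cbox 0 1) (\<lambda>x. (character k x * \<sigma> k x) * (\<Sum>m\<in>F. character (- m) x * f m))"
      by (rule sym, rule integral_unique, rule I)
    also have "\<dots> = integral (cbox 0 1) (\<lambda>x. \<Sum>m\<in>F. (character (k - m) x * \<sigma> k x) * f m)"
      by (simp add: sum_distrib_left mult_ac character_add[of _ "- _", simplified])
    also have "\<dots> = (\<Sum>m\<in>F. fcoeff (k - m) (\<sigma> k) * f m)"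
      by (subst integral_sum) (simp_all add: True fcoeff_def integrable_continuous continuous_intros cg)
    finally show ?thesis .
  next
    \<comment> \<open>For infinite \<open>F\<close> the sum is 0 by convention, so both sides
      vanish; this allows an equation between functions of \<open>F\<close>.\<close>
    case False
    then show ?thesis using I[of F] by simp
  qed
  then have "I = sum (\<lambda>m. fcoeff (k - m) (\<sigma> k) * f m)" by (rule ext)
  then have "((\<lambda>m. fcoeff (k - m) (\<sigma> k) * f m) has_sum J) UNIV"
    using lim by (simp add: has_sum_def)
  moreover have "Op \<sigma> f k = J"
  proof -
    \<comment> \<open>\<open>J\<close> is a gauge integral while \<open>Op\<close> uses the Lebesgue
      integral; they agree because the integrand is continuous on a compact set.\<close>
    have "set_integrable lborel (cbox 0 1) (\<lambda>x. (character k x * \<sigma> k x) * lattice_fourier f x)"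
      unfolding set_integrable_def
      by (intro borel_integrable_compact compact_cbox continuous_intros cg cf)
    then show ?thesis
      using J set_borel_integral_eq_integral(2) 
      by (fastforce simp: Op_def character_def[symmetric] integral_unique)
  qed
  ultimately show ?thesis by (simp add: infsumI)
qed

theorem theorem5p2:
  fixes \<kappa> :: nat and \<sigma> :: "int ^ 'n \<Rightarrow> real ^ 'n \<Rightarrow> complex"
  assumes "real \<kappa> > real CARD('n) / 2"
    and "\<forall>k. cont_diff_torus \<kappa> (\<sigma> k)"
    and "\<exists>C. \<forall>\<beta>. sum \<beta> UNIV \<le> \<kappa> \<longrightarrow> (\<forall>k x. norm (multi_partial \<beta> (\<sigma> k) x) \<le> C)"
  shows "\<exists>T. bounded_operator_ell2 T \<and> (\<forall>f. rapidly_decreasing f \<longrightarrow> T f = Op \<sigma> f)"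
proof (intro exI conjI allI impI)
  obtain C where C: "\<And>\<beta> k x. sum \<beta> UNIV \<le> \<kappa> \<Longrightarrow> norm (multi_partial \<beta> (\<sigma> k) x) \<le> C"
    using assms(3) by blast
  let ?w = "lattice_weight \<kappa> :: int ^ 'n \<Rightarrow> real"
  \<comment> \<open>The matrix acts on every square-summable \<open>f\<close> and is the witness for
    the extension. Its weight depends only on \<open>k - m\<close>, so reindexing by the difference
    turns rows into \<open>weighted_bessel\<close>, uniformly in \<open>k\<close>, and columns into
    partial sums of \<open>1 / ?w\<close>.\<close>
  show "bounded_operator_ell2 (\<lambda>f k. \<Sum>\<^sub>\<infinity>m. fcoeff (k - m) (\<sigma> k) * f m)"
  proof (rule bounded_operator_ell2_kernel[where p = "\<lambda>k m. ?w (k - m)"])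
    show "0 < ?w (k - m)" for k m using lattice_weight_ge_1[of \<kappa> "k - m"] by simp
    fix F :: "(int ^ 'n) set" and k assume F: "finite F"
    have "(\<Sum>m\<in>F. ?w (k - m) * (norm (fcoeff (k - m) (\<sigma> k)))\<^sup>2) =
        (\<Sum>l\<in>(\<lambda>m. k - m) ` F. ?w l * (norm (fcoeff l (\<sigma> k)))\<^sup>2)"
      by (subst sum.reindex) (auto simp: inj_on_def)
    also have "\<dots> \<le> (1 + real CARD('n)) * C\<^sup>2"
      using assms(2) C F by (intro weighted_bessel) auto
    finally show "(\<Sum>m\<in>F. ?w (k - m) * (norm (fcoeff (k - m) (\<sigma> k)))\<^sup>2) \<le> (1 + real CARD('n)) * C\<^sup>2" .
  next
    fix F :: "(int ^ 'n) set" and m assume F: "finite F"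
    have "(\<Sum>k\<in>F. 1 / ?w (k - m)) = (\<Sum>l\<in>(\<lambda>k. k - m) ` F. 1 / ?w l)"
      by (subst sum.reindex) (auto simp: inj_on_def)
    also have "\<dots> \<le> (\<Sum>\<^sub>\<infinity>l. 1 / ?w l)"
      using F lattice_weight_ge_1[of \<kappa>]
      by (intro finite_sum_le_infsum lattice_weight_summable assms(1)) (auto intro: order_trans[OF zero_le_one])
    finally show "(\<Sum>k\<in>F. 1 / ?w (k - m)) \<le> (\<Sum>\<^sub>\<infinity>l. 1 / ?w l)" .
  qed
  show "(\<lambda>k. \<Sum>\<^sub>\<infinity>m. fcoeff (k - m) (\<sigma> k) * f m) = Op \<sigma> f" if "rapidly_decreasing f" for f
    using assms(2) rapidly_decreasing_abs_summable[OF that]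
    by (intro ext Op_eq_kernel[symmetric]) (auto intro: cont_diff_torus_continuous)
qed

end
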